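(* Let $f_\xi(x)=b+\sum_{\ell=1}^\infty\omega_\ell\xi_\ell\phi_\ell(x)$ with $|\xi_\ell|\le1$, $|\phi_\ell(x)|\le1$, and assume $A:=\sum_{\ell=1}^\infty|\omega_\ell|<\min\{b,1-b\}$. For every fixed $x$, the lazy decision procedure stops after finitely many coefficient reveals almost surely and returns $J_f(x)=\mathbf 1_{\{U<f_\xi(x)\}}$. Hence, conditional on $f_\xi$, $J_f(x)\sim\operatorname{Bernoulli}(f_\xi(x))$. If $\tau$ is the number of revealed coefficients, then \[ \mathbb P(\tau>r\mid\xi)\le\min\{1,2R_r\},\qquad \mathbb E(\tau\mid\xi)\le\sum_{r=0}^\infty\min\{1,2R_r\}. \] In particular, if $|\omega_\ell|=A(1-\rho)\rho^{\ell-1}$ for all $\ell\ge 1$, with $0<\rho<1$, then $R_r=A\rho^r$ and, when $2A\le1$, $\mathbb E\tau\le\frac{2A}{1-\rho}$.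
   Context: $\{\phi_\ell\}_{\ell\ge1}$ are measurable real functions on a domain $\mathcal D$ with $|\phi_\ell(x)|\le1$; $b$ and $\omega_\ell$ are real; $\xi=(\xi_\ell)_{\ell\ge1}$ is a random element of $[-1,1]^{\mathbb N}$ (with its product $\sigma$-algebra and a product prior). For $r\ge0$ put \[ S_r(x)=b+\sum_{\ell=1}^r\omega_\ell\xi_\ell\phi_\ell(x),\qquad R_r=\sum_{\ell>r}|\omega_\ell|. \] Lazy decision procedure at $x$: draw a single $U\sim\operatorname{Unif}(0,1)$ independent of $\xi$; reveal coefficients $\xi_1,\xi_2,\dots$ sequentially until, with $r$ coefficients revealed ($r=0,1,2,\dots$), either $U<S_r(x)-R_r$, in which case return $1$, or $U>S_r(x)+R_r$, in which case return $0$. The number $r$ at which it stops is $\tau$. *)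

theory Defs
  imports "HOL-Probability.Probability"
begin

text \<open>
  Coefficients, weights and basis functions are families indexed by \<open>\<ell> \<ge> 1\<close>; their value at
  index \<open>0\<close> is never used.
\<close>

definition partial_sum ::
  "real \<Rightarrow> (nat \<Rightarrow> real) \<Rightarrow> (nat \<Rightarrow> 'd \<Rightarrow> real) \<Rightarrow> (nat \<Rightarrow> real) \<Rightarrow> 'd \<Rightarrow> nat \<Rightarrow> real" where
  "partial_sum b \<omega> \<phi> \<xi> x r = b + (\<Sum>l=1..r. \<omega> l * \<xi> l * \<phi> l x)"

definition series_fun ::
  "real \<Rightarrow> (nat \<Rightarrow> real) \<Rightarrow> (nat \<Rightarrow> 'd \<Rightarrow> real) \<Rightarrow> (nat \<Rightarrow> real) \<Rightarrow> 'd \<Rightarrow> real" where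
  "series_fun b \<omega> \<phi> \<xi> x = b + (\<Sum>l. \<omega> (Suc l) * \<xi> (Suc l) * \<phi> (Suc l) x)"

definition tail_bound :: "(nat \<Rightarrow> real) \<Rightarrow> nat \<Rightarrow> real" where
  "tail_bound \<omega> r = (\<Sum>l. \<bar>\<omega> (r + Suc l)\<bar>)"

text \<open>
  Outcome of the test made with \<open>r\<close> coefficients revealed; \<open>None\<close> means that the procedure goes on
  and reveals the next coefficient. The tail bound is nonnegative whenever the weights are
  absolutely summable, so the order of the two tests is immaterial.
\<close>

definition lazy_test ::
  "real \<Rightarrow> (nat \<Rightarrow> real) \<Rightarrow> (nat \<Rightarrow> 'd \<Rightarrow> real) \<Rightarrow> (nat \<Rightarrow> real) \<Rightarrow> real \<Rightarrow> 'd \<Rightarrow> nat \<Rightarrow> real option" where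
  "lazy_test b \<omega> \<phi> \<xi> u x r =
     (if u < partial_sum b \<omega> \<phi> \<xi> x r - tail_bound \<omega> r then Some 1
      else if u > partial_sum b \<omega> \<phi> \<xi> x r + tail_bound \<omega> r then Some 0
      else None)"

text \<open>The number of revealed coefficients is \<open>\<infinity>\<close> if the procedure never stops.\<close>

definition lazy_time ::
  "real \<Rightarrow> (nat \<Rightarrow> real) \<Rightarrow> (nat \<Rightarrow> 'd \<Rightarrow> real) \<Rightarrow> (nat \<Rightarrow> real) \<Rightarrow> real \<Rightarrow> 'd \<Rightarrow> enat" where
  "lazy_time b \<omega> \<phi> \<xi> u x =
     (if \<exists>r. lazy_test b \<omega> \<phi> \<xi> u x r \<noteq> None
      then enat (LEAST r. lazy_test b \<omega> \<phi> \<xi> u x r \<noteq> None)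
      else \<infinity>)"

definition lazy_output ::
  "real \<Rightarrow> (nat \<Rightarrow> real) \<Rightarrow> (nat \<Rightarrow> 'd \<Rightarrow> real) \<Rightarrow> (nat \<Rightarrow> real) \<Rightarrow> real \<Rightarrow> 'd \<Rightarrow> real option" where
  "lazy_output b \<omega> \<phi> \<xi> u x =
     (case lazy_time b \<omega> \<phi> \<xi> u x of enat r \<Rightarrow> lazy_test b \<omega> \<phi> \<xi> u x r | \<infinity> \<Rightarrow> None)"

definition J_fun :: "('d \<Rightarrow> real) \<Rightarrow> real \<Rightarrow> 'd \<Rightarrow> real" where
  "J_fun f u x = indicator {u. u < f x} u"

definition coeff_space :: "(nat \<Rightarrow> real) measure" where
  "coeff_space = (\<Pi>\<^sub>M l\<in>{1..}. restrict_space borel {-1..1})"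

text \<open>The law \<open>Bernoulli(p)\<close> on the real values \<open>0\<close> and \<open>1\<close>.\<close>

definition bernoulli01 :: "real \<Rightarrow> real pmf" where
  "bernoulli01 p = map_pmf of_bool (bernoulli_pmf p)"

text \<open>
  The \<open>\<sigma>\<close>-algebra on the sample space \<open>M\<close> generated by a random element \<open>X\<close> with values in \<open>N\<close>.
\<close>

abbreviation gen_sigma :: "'s measure \<Rightarrow> ('s \<Rightarrow> 'a) \<Rightarrow> 'a measure \<Rightarrow> 's measure" where
  "gen_sigma M X N \<equiv> vimage_algebra (space M) X N"

end

theory Submission imports Defs begin

text \<open>
  Two ideas carry the proof. The first is deterministic. The tail after \<open>r\<close> terms of the series is at
  most \<open>R\<^sub>r\<close> in absolute value (\<open>truncation_error\<close>), so the final value \<open>f\<^sub>\<xi>(x)\<close> lies in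
  \<open>[S\<^sub>r(x) - R\<^sub>r, S\<^sub>r(x) + R\<^sub>r]\<close>. A threshold outside that interval is thus already on the same
  side of \<open>f\<^sub>\<xi>(x)\<close> as it is of the interval, and the early answer agrees with the indicator
  of \<open>U < f\<^sub>\<xi>(x)\<close> (\<open>lazy_test_sound\<close>). Conversely, a procedure that is still running after \<open>r\<close> reveals has
  \<open>U\<close> inside an interval of length \<open>2 R\<^sub>r\<close> that depends on \<open>\<xi>\<close> alone.

  The second is probabilistic. Since \<open>U\<close> is independent of \<open>\<xi>\<close>, conditioning on \<open>\<xi>\<close> means
  freezing \<open>\<xi>\<close> and integrating over the law of \<open>U\<close> (\<open>nn_cond_exp_pair\<close>, \<open>real_cond_exp_pair\<close>).
  Each probabilistic claim then becomes a computation with the uniform law for one fixed coefficient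
  sequence: an interval of length \<open>2 R\<^sub>r\<close> has probability at most \<open>min 1 (2 R\<^sub>r)\<close>; hence never
  stopping has probability \<open>0\<close>, because \<open>R\<^sub>r\<close> tends to \<open>0\<close>; and summing the tail probabilities
  bounds the mean, where geometric weights make the \<open>R\<^sub>r\<close> a geometric sequence. For the Bernoulli law the frozen element is the random function
  \<open>f\<^sub>\<xi>\<close> itself, which is a measurable image of \<open>\<xi>\<close> and so is independent of \<open>U\<close> too. The
  assumption \<open>A < min b (1 - b)\<close> puts its values in \<open>[0, 1]\<close>, where a uniform variable falls below
  \<open>p\<close> with probability exactly \<open>p\<close>.
\<close>

section \<open>Conditioning on one of two independent random elements\<close>

lemma (in prob_space) sigma_finite_subalgebra_gen_sigma:
  assumes "random_variable N X"
  shows "sigma_finite_subalgebra M (gen_sigma M X N)"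
proof -
  have "sets (gen_sigma M X N) \<subseteq> sets M"
    using assms by (intro sets_image_in_sets) auto
  then have "subalgebra M (gen_sigma M X N)"
    by (auto simp: subalgebra_def)
  then show ?thesis
    by (intro finite_measure_subalgebra_is_sigma_finite finite_measure_subalgebra.intro
        finite_measure_subalgebra_axioms.intro finite_measure_axioms)
qed

text \<open>
  The two random elements may have values in different types, whereas \<open>indep_var\<close> needs a common one;
  independence is therefore stated for the generated \<open>\<sigma>\<close>-algebras.
\<close>

locale indep_pair = prob_space M
  for M :: "'s measure" and N :: "'a measure" and X :: "'s \<Rightarrow> 'a" and K :: "'b measure" and U :: "'s \<Rightarrow> 'b" +
  assumes X [measurable]: "random_variable N X"
    and U [measurable]: "random_variable K U"
    and indep: "indep_set (sets (gen_sigma M U K)) (sets (gen_sigma M X N))"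
begin

lemma distr_pair: "distr M (N \<Otimes>\<^sub>M K) (\<lambda>s. (X s, U s)) = distr M N X \<Otimes>\<^sub>M distr M K U"
proof (rule pair_measure_eqI[symmetric])
  interpret NX: prob_space "distr M N X" by (rule prob_space_distr[OF X])
  interpret KU: prob_space "distr M K U" by (rule prob_space_distr[OF U])
  show "sigma_finite_measure (distr M N X)" "sigma_finite_measure (distr M K U)"
    by unfold_locales
  show "sets (distr M N X \<Otimes>\<^sub>M distr M K U) = sets (distr M (N \<Otimes>\<^sub>M K) (\<lambda>s. (X s, U s)))"
    by (simp cong: sets_pair_measure_cong)
  fix A B assume "A \<in> sets (distr M N X)" "B \<in> sets (distr M K U)"
  then have [measurable]: "A \<in> sets N" "B \<in> sets K" by simp_all
  have "emeasure (distr M N X) A * emeasure (distr M K U) B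
      = ennreal (prob (U -` B \<inter> space M) * prob (X -` A \<inter> space M))"
    by (simp add: emeasure_distr emeasure_eq_measure ennreal_mult mult.commute)
  also have "prob (U -` B \<inter> space M) * prob (X -` A \<inter> space M)
      = prob ((U -` B \<inter> space M) \<inter> (X -` A \<inter> space M))"
    by (intro indep_setD[OF indep, symmetric] in_vimage_algebra) simp_all
  also have "(U -` B \<inter> space M) \<inter> (X -` A \<inter> space M) = (\<lambda>s. (X s, U s)) -` (A \<times> B) \<inter> space M"
    by auto
  finally show "emeasure (distr M N X) A * emeasure (distr M K U) B
      = emeasure (distr M (N \<Otimes>\<^sub>M K) (\<lambda>s. (X s, U s))) (A \<times> B)"
    by (simp add: emeasure_distr emeasure_eq_measure)
qed

lemma nn_integral_pair:
  assumes h [measurable]: "h \<in> borel_measurable (N \<Otimes>\<^sub>M K)"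
  shows "(\<integral>\<^sup>+ s. h (X s, U s) \<partial>M) = (\<integral>\<^sup>+ s. (\<integral>\<^sup>+ u. h (X s, u) \<partial>distr M K U) \<partial>M)"
proof -
  interpret KU: prob_space "distr M K U" by (rule prob_space_distr[OF U])
  have "(\<integral>\<^sup>+ s. h (X s, U s) \<partial>M) = (\<integral>\<^sup>+ z. h z \<partial>distr M (N \<Otimes>\<^sub>M K) (\<lambda>s. (X s, U s)))"
    by (subst nn_integral_distr) auto
  also have "\<dots> = (\<integral>\<^sup>+ z. h z \<partial>(distr M N X \<Otimes>\<^sub>M distr M K U))"
    by (simp add: distr_pair)
  also have "\<dots> = (\<integral>\<^sup>+ x. (\<integral>\<^sup>+ u. h (x, u) \<partial>distr M K U) \<partial>distr M N X)"
    by (rule KU.nn_integral_fst[symmetric]) simp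
  also have "\<dots> = (\<integral>\<^sup>+ s. (\<integral>\<^sup>+ u. h (X s, u) \<partial>distr M K U) \<partial>M)"
    by (subst nn_integral_distr) auto
  finally show ?thesis .
qed

text \<open>
  The frozen integral is a measurable function of \<open>X\<close>, and an event generated by \<open>X\<close> has the form
  \<open>X \<in> C\<close>. Its indicator is constant for the inner integral, so Fubini's theorem applied to
  \<open>h (x, u) * indicator C x\<close> gives the identity that characterizes the conditional expectation.
\<close>

lemma nn_cond_exp_pair:
  assumes h [measurable]: "h \<in> borel_measurable (N \<Otimes>\<^sub>M K)"
  shows "AE s in M. nn_cond_exp M (gen_sigma M X N) (\<lambda>s. h (X s, U s)) s
           = (\<integral>\<^sup>+ u. h (X s, u) \<partial>distr M K U)"
proof -
  interpret KU: prob_space "distr M K U" by (rule prob_space_distr[OF U])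
  interpret F: sigma_finite_subalgebra M "gen_sigma M X N" by (rule sigma_finite_subalgebra_gen_sigma[OF X])
  define g where "g x = (\<integral>\<^sup>+ u. h (x, u) \<partial>distr M K U)" for x
  have g [measurable]: "g \<in> borel_measurable N"
    unfolding g_def by measurable
  have XF: "X \<in> measurable (gen_sigma M X N) N"
    using measurable_space[OF X] by (intro measurable_vimage_algebra1) auto
  have "AE s in M. g (X s) = nn_cond_exp M (gen_sigma M X N) (\<lambda>s. h (X s, U s)) s"
  proof (rule F.nn_cond_exp_charact)
    fix A assume "A \<in> sets (gen_sigma M X N)"
    then obtain C where C [measurable]: "C \<in> sets N" and A: "A = X -` C \<inter> space M"
      using measurable_space[OF X] by (subst (asm) sets_vimage_algebra2) auto
    have "(\<integral>\<^sup>+ s \<in> A. h (X s, U s) \<partial>M) = (\<integral>\<^sup>+ s. h (X s, U s) * indicator C (X s) \<partial>M)"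
      by (intro nn_integral_cong) (auto simp: A indicator_def)
    also have "\<dots> = (\<integral>\<^sup>+ s. (\<integral>\<^sup>+ u. h (X s, u) * indicator C (X s) \<partial>distr M K U) \<partial>M)"
      using nn_integral_pair[of "\<lambda>z. h z * indicator C (fst z)"] by simp
    also have "\<dots> = (\<integral>\<^sup>+ s \<in> A. g (X s) \<partial>M)"
    proof (intro nn_integral_cong)
      fix s assume "s \<in> space M"
      then have "X s \<in> space N" by (rule measurable_space[OF X])
      then have "(\<lambda>u. h (X s, u)) \<in> borel_measurable (distr M K U)" by measurable
      then have "(\<integral>\<^sup>+ u. h (X s, u) * indicator C (X s) \<partial>distr M K U) = g (X s) * indicator C (X s)"
        unfolding g_def by (rule nn_integral_multc)
      then show "(\<integral>\<^sup>+ u. h (X s, u) * indicator C (X s) \<partial>distr M K U) = g (X s) * indicator A s"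
        using \<open>s \<in> space M\<close> by (simp add: A indicator_def)
    qed
    finally show "(\<integral>\<^sup>+ s \<in> A. h (X s, U s) \<partial>M) = (\<integral>\<^sup>+ s \<in> A. g (X s) \<partial>M)" .
  next
    show "(\<lambda>s. g (X s)) \<in> borel_measurable (gen_sigma M X N)"
      by (rule measurable_compose[OF XF g])
  qed simp
  then show ?thesis
    by (simp add: g_def eq_commute)
qed

text \<open>
  The real conditional expectation is the difference of those of the positive and the negative part;
  for an indicator the latter is \<open>0\<close> almost everywhere. Prescribing \<open>g\<close> only on \<open>space M\<close> lets it be
  either a predicate in \<open>X\<close> and \<open>U\<close> or the indicator of a subset of \<open>space M\<close>.
\<close>

lemma real_cond_exp_pair:
  assumes P: "Measurable.pred (N \<Otimes>\<^sub>M K) (\<lambda>z. P (fst z) (snd z))"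
    and g: "\<And>s. s \<in> space M \<Longrightarrow> g s = of_bool (P (X s) (U s))"
  shows "AE s in M. real_cond_exp M (gen_sigma M X N) g s
           = measure (distr M K U) {u \<in> space K. P (X s) u}"
proof -
  note [measurable] = P
  interpret KU: prob_space "distr M K U" by (rule prob_space_distr) measurable
  interpret F: sigma_finite_subalgebra M "gen_sigma M X N" by (rule sigma_finite_subalgebra_gen_sigma) measurable
  have pred: "Measurable.pred M (\<lambda>s. P (X s) (U s))"
    using measurable_compose[of "\<lambda>s. (X s, U s)" M "N \<Otimes>\<^sub>M K", OF _ P] by simp
  have g' [measurable]: "g \<in> borel_measurable M"
    using pred by (subst measurable_cong[OF g]) auto
  have "AE s in M. nn_cond_exp M (gen_sigma M X N) (\<lambda>s. ennreal (g s)) s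
      = nn_cond_exp M (gen_sigma M X N) (\<lambda>s. ennreal (of_bool (P (X s) (U s)))) s"
    using pred by (intro F.nn_cond_exp_cong AE_I2) (auto simp: g)
  moreover have "AE s in M. nn_cond_exp M (gen_sigma M X N) (\<lambda>s. ennreal (of_bool (P (X s) (U s)))) s
      = (\<integral>\<^sup>+ u. ennreal (of_bool (P (X s) u)) \<partial>distr M K U)"
    using nn_cond_exp_pair[of "\<lambda>z. ennreal (of_bool (P (fst z) (snd z)))"] by simp
  moreover have "AE s in M. nn_cond_exp M (gen_sigma M X N) (\<lambda>s. ennreal (- g s)) s
      = nn_cond_exp M (gen_sigma M X N) (\<lambda>s. 0) s"
    by (intro F.nn_cond_exp_cong AE_I2) (auto simp: g ennreal_neg)
  moreover have "AE s in M. nn_cond_exp M (gen_sigma M X N) (\<lambda>s. 0) s = 0"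
    using nn_cond_exp_pair[of "\<lambda>_. 0"] by simp
  ultimately have "AE s in M. real_cond_exp M (gen_sigma M X N) g s
      = enn2real (\<integral>\<^sup>+ u. ennreal (of_bool (P (X s) u)) \<partial>distr M K U)"
    by eventually_elim (simp add: real_cond_exp_def)
  then show ?thesis
  proof (rule AE_mp, intro AE_I2 impI)
    fix s assume s: "s \<in> space M"
      and eq: "real_cond_exp M (gen_sigma M X N) g s
        = enn2real (\<integral>\<^sup>+ u. ennreal (of_bool (P (X s) u)) \<partial>distr M K U)"
    have "X s \<in> space N" using s by (rule measurable_space[OF X])
    then have "Measurable.pred K (\<lambda>u. P (X s) u)"
      using measurable_compose[OF measurable_Pair1' P, of "X s"] by simp
    then have "{u \<in> space K. P (X s) u} \<in> sets (distr M K U)" by simp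
    moreover have "(\<integral>\<^sup>+ u. ennreal (of_bool (P (X s) u)) \<partial>distr M K U)
        = (\<integral>\<^sup>+ u. indicator {u \<in> space K. P (X s) u} u \<partial>distr M K U)"
      by (intro nn_integral_cong) (auto simp: indicator_def)
    ultimately show "real_cond_exp M (gen_sigma M X N) g s
        = measure (distr M K U) {u \<in> space K. P (X s) u}"
      by (simp only: eq nn_integral_indicator measure_def)
  qed
qed

end

section \<open>The uniform distribution on the unit interval\<close>

abbreviation unif :: "real measure" where
  "unif \<equiv> uniform_measure lborel {0<..<1}"

lemma prob_space_unif: "prob_space unif"
  by (rule prob_space_uniform_measure) auto

lemma measure_unif_Icc_le:
  assumes "a \<le> b"
  shows "measure unif {a..b} \<le> b - a"
proof -
  have "measure unif {a..b} = measure lborel ({0<..<1} \<inter> {a..b})"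
    by (simp add: measure_uniform_measure)
  also have "\<dots> \<le> measure lborel {a..b}"
    by (rule measure_mono_fmeasurable) (auto simp: fmeasurable_def emeasure_lborel_Icc_eq)
  finally show ?thesis using assms by simp
qed

lemma measure_unif_lessThan:
  assumes "0 \<le> p" "p \<le> 1"
  shows "measure unif {u. u < p} = p"
proof -
  have "{0<..<1} \<inter> {u. u < p} = {0<..<p}" using assms by auto
  then show ?thesis using assms by (simp add: measure_uniform_measure)
qed

text \<open>
  A law on \<open>{0, 1}\<close> is determined on \<open>B\<close> by whether \<open>B\<close> contains \<open>1\<close> and whether it contains \<open>0\<close>,
  so that only the probabilities of \<open>u < p\<close> and of its complement enter.
\<close>

lemma measure_unif_threshold:
  assumes p: "0 \<le> p" "p \<le> 1"
  shows "measure unif {u. indicator {u. u < p} u \<in> B} = measure_pmf.prob (bernoulli01 p) B"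
proof -
  interpret prob_space unif by (rule prob_space_unif)
  have neg: "measure unif {u. \<not> u < p} = 1 - p"
    using prob_compl[of "{u. u < p}"] measure_unif_lessThan[OF p] by (simp add: Compl_eq[symmetric] Compl_eq_Diff_UNIV Collect_neg_eq)
  have bern: "measure_pmf.prob (bernoulli01 p) B = measure_pmf.prob (bernoulli_pmf p) {c. of_bool c \<in> B}"
    by (simp add: bernoulli01_def vimage_def)
  consider "1 \<in> B" "0 \<in> B" | "1 \<in> B" "0 \<notin> B" | "1 \<notin> B" "0 \<in> B" | "1 \<notin> B" "0 \<notin> B" by blast
  then show ?thesis
  proof cases
    case 1
    then have "{u. indicator {u. u < p} u \<in> B} = UNIV" "{c. of_bool c \<in> B} = UNIV"
      by (auto simp: indicator_def of_bool_def)
    then show ?thesis using prob_space by (simp add: bern)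
  next
    case 2
    then have "{u. indicator {u. u < p} u \<in> B} = {u. u < p}" "{c. of_bool c \<in> B} = {True}"
      by (auto simp: indicator_def of_bool_def split: if_splits)
    then show ?thesis using measure_unif_lessThan[OF p] p by (simp add: bern measure_pmf_single)
  next
    case 3
    then have "{u. indicator {u. u < p} u \<in> B} = {u. \<not> u < p}" "{c. of_bool c \<in> B} = {False}"
      by (auto simp: indicator_def of_bool_def split: if_splits)
    then show ?thesis using neg p by (simp add: bern measure_pmf_single)
  next
    case 4
    then have "{u. indicator {u. u < p} u \<in> B} = {}" "{c. of_bool c \<in> B} = {}"
      by (auto simp: indicator_def of_bool_def split: if_splits)
    then show ?thesis by (simp add: bern)
  qed
qed

section \<open>Truncation error and stopping\<close>

lemma lazy_time_gt_iff:
  "enat r < lazy_time b \<omega> \<phi> z u x \<longleftrightarrow> (\<forall>q\<le>r. lazy_test b \<omega> \<phi> z u x q = None)"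
proof (cases "\<exists>q. lazy_test b \<omega> \<phi> z u x q \<noteq> None")
  case True
  let ?n = "LEAST q. lazy_test b \<omega> \<phi> z u x q \<noteq> None"
  have "lazy_test b \<omega> \<phi> z u x ?n \<noteq> None" using True by (rule LeastI_ex)
  moreover have "q < ?n \<Longrightarrow> lazy_test b \<omega> \<phi> z u x q = None" for q using not_less_Least by blast
  ultimately have "r < ?n \<longleftrightarrow> (\<forall>q\<le>r. lazy_test b \<omega> \<phi> z u x q = None)"
    by (meson le_less_trans linorder_not_le)
  with True show ?thesis by (simp add: lazy_time_def)
next
  case False
  then show ?thesis by (simp add: lazy_time_def)
qed

lemma lazy_output_at_stop:
  assumes "lazy_time b \<omega> \<phi> z u x \<noteq> \<infinity>"
  shows "\<exists>r v. lazy_test b \<omega> \<phi> z u x r = Some v \<and> lazy_output b \<omega> \<phi> z u x = Some v"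
proof -
  from assms have ex: "\<exists>r. lazy_test b \<omega> \<phi> z u x r \<noteq> None"
    by (auto simp: lazy_time_def split: if_splits)
  from LeastI_ex[OF this] show ?thesis
    using ex by (auto simp: lazy_output_def lazy_time_def)
qed

locale lazy_series =
  fixes b :: real and \<omega> :: "nat \<Rightarrow> real" and \<phi> :: "nat \<Rightarrow> 'd \<Rightarrow> real" and x :: 'd
  assumes weights: "summable (\<lambda>l. \<bar>\<omega> (Suc l)\<bar>)"
    and basis: "\<And>l. l \<ge> 1 \<Longrightarrow> \<bar>\<phi> l x\<bar> \<le> 1"
begin

lemma summable_tail: "summable (\<lambda>l. \<bar>\<omega> (r + Suc l)\<bar>)"
  using summable_ignore_initial_segment[OF weights, of r] by (simp add: add.commute)

lemma tail_bound_nonneg: "0 \<le> tail_bound \<omega> r"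
  unfolding tail_bound_def by (intro suminf_nonneg summable_tail) simp

lemma tail_bound_tendsto_0: "tail_bound \<omega> \<longlonglongrightarrow> 0"
proof -
  have "tail_bound \<omega> = (\<lambda>r. (\<Sum>l. \<bar>\<omega> (Suc l)\<bar>) - (\<Sum>l<r. \<bar>\<omega> (Suc l)\<bar>))"
    using suminf_minus_initial_segment[OF weights]
    by (simp add: fun_eq_iff tail_bound_def add.commute)
  moreover have "\<dots> \<longlonglongrightarrow> (\<Sum>l. \<bar>\<omega> (Suc l)\<bar>) - (\<Sum>l. \<bar>\<omega> (Suc l)\<bar>)"
    by (intro tendsto_diff tendsto_const summable_LIMSEQ weights)
  ultimately show ?thesis by simp
qed

context
  fixes z :: "nat \<Rightarrow> real"
  assumes coeffs: "\<And>l. l \<ge> 1 \<Longrightarrow> \<bar>z l\<bar> \<le> 1"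
begin

text \<open>
  Each omitted term is at most \<open>\<bar>\<omega> l\<bar>\<close>, since coefficient and basis value are both at most \<open>1\<close> in
  absolute value.
\<close>

lemma truncation_error: "\<bar>series_fun b \<omega> \<phi> z x - partial_sum b \<omega> \<phi> z x r\<bar> \<le> tail_bound \<omega> r"
proof -
  define t where "t l = \<omega> (Suc l) * z (Suc l) * \<phi> (Suc l) x" for l
  have t: "\<bar>t l\<bar> \<le> \<bar>\<omega> (Suc l)\<bar>" for l
  proof -
    have "\<bar>z (Suc l)\<bar> * \<bar>\<phi> (Suc l) x\<bar> \<le> 1"
      using coeffs[of "Suc l"] basis[of "Suc l"] by (intro mult_le_one) auto
    from mult_left_mono[OF this, of "\<bar>\<omega> (Suc l)\<bar>"] show ?thesis
      by (simp add: t_def abs_mult mult.assoc)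
  qed
  have st: "summable t"
    using t by (intro summable_comparison_test'[OF weights, of 0]) simp
  have "(\<Sum>l=1..r. \<omega> l * z l * \<phi> l x) = (\<Sum>l<r. t l)"
    unfolding t_def by (rule sum.reindex_bij_witness[of _ Suc "\<lambda>l. l - 1"]) auto
  then have "series_fun b \<omega> \<phi> z x - partial_sum b \<omega> \<phi> z x r = (\<Sum>l. t (l + r))"
    using suminf_minus_initial_segment[OF st, of r]
    by (simp add: series_fun_def partial_sum_def t_def)
  moreover have "\<bar>\<Sum>l. t (l + r)\<bar> \<le> (\<Sum>l. \<bar>\<omega> (r + Suc l)\<bar>)"
  proof -
    have le: "\<bar>t (l + r)\<bar> \<le> \<bar>\<omega> (r + Suc l)\<bar>" for l
      using t[of "l + r"] by (simp add: add.commute)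
    then have abs: "summable (\<lambda>l. \<bar>t (l + r)\<bar>)"
      by (intro summable_comparison_test'[OF summable_tail[of r], of 0]) simp
    then have "\<bar>\<Sum>l. t (l + r)\<bar> \<le> (\<Sum>l. \<bar>t (l + r)\<bar>)"
      by (rule summable_rabs)
    also have "\<dots> \<le> (\<Sum>l. \<bar>\<omega> (r + Suc l)\<bar>)"
      by (intro suminf_le le abs summable_tail)
    finally show ?thesis .
  qed
  ultimately show ?thesis by (simp add: tail_bound_def)
qed

text \<open>
  By \<open>truncation_error\<close> the value of the series lies between the two numbers that the test compares \<open>u\<close>
  with. This covers the case \<open>u = f x\<close> as well: both tests are strict, hence neither succeeds there.
\<close>

lemma lazy_test_sound:
  assumes "lazy_test b \<omega> \<phi> z u x r = Some v"
  shows "v = J_fun (series_fun b \<omega> \<phi> z) u x"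
  using assms truncation_error[of r]
  by (auto simp: lazy_test_def J_fun_def abs_le_iff split: if_splits)

lemma lazy_output_correct:
  assumes "lazy_time b \<omega> \<phi> z u x \<noteq> \<infinity>"
  shows "lazy_output b \<omega> \<phi> z u x = Some (J_fun (series_fun b \<omega> \<phi> z) u x)"
  using lazy_output_at_stop[OF assms] lazy_test_sound by auto

end

lemma undecided_interval:
  assumes "enat r < lazy_time b \<omega> \<phi> z u x"
  shows "u \<in> {partial_sum b \<omega> \<phi> z x r - tail_bound \<omega> r .. partial_sum b \<omega> \<phi> z x r + tail_bound \<omega> r}"
proof -
  have "lazy_test b \<omega> \<phi> z u x r = None"
    using assms by (simp add: lazy_time_gt_iff)
  then show ?thesis by (simp add: lazy_test_def split: if_splits)
qed

text \<open>
  Stated for an arbitrary set of undecided thresholds, so that it applies both to the event of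
  running beyond \<open>r\<close> reveals and to the event of never stopping.
\<close>

lemma measure_unif_undecided:
  assumes "\<And>u. u \<in> E \<Longrightarrow> enat r < lazy_time b \<omega> \<phi> z u x"
  shows "measure unif E \<le> min 1 (2 * tail_bound \<omega> r)"
proof -
  interpret prob_space unif by (rule prob_space_unif)
  let ?S = "partial_sum b \<omega> \<phi> z x r" and ?R = "tail_bound \<omega> r"
  have "measure unif E \<le> measure unif {?S - ?R .. ?S + ?R}"
    using undecided_interval[OF assms] by (intro finite_measure_mono) auto
  also have "\<dots> \<le> 2 * ?R"
    using measure_unif_Icc_le[of "?S - ?R" "?S + ?R"] tail_bound_nonneg[of r] by simp
  finally show ?thesis by simp
qed

lemma measure_unif_never:
  "measure unif {u. lazy_time b \<omega> \<phi> z u x = \<infinity>} = 0"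
proof -
  have "measure unif {u. lazy_time b \<omega> \<phi> z u x = \<infinity>} \<le> 2 * tail_bound \<omega> r" for r
    using measure_unif_undecided[of "{u. lazy_time b \<omega> \<phi> z u x = \<infinity>}" r z] by simp
  moreover have "(\<lambda>r. 2 * tail_bound \<omega> r) \<longlonglongrightarrow> 0"
    using tendsto_mult_left[OF tail_bound_tendsto_0, of 2] by simp
  ultimately have "measure unif {u. lazy_time b \<omega> \<phi> z u x = \<infinity>} \<le> 0"
    by (intro LIMSEQ_le_const[where X = "\<lambda>r. 2 * tail_bound \<omega> r"]) blast+
  then show ?thesis by (simp add: measure_le_0_iff)
qed

end

section \<open>Measurability\<close>

lemma measurable_threshold:
  fixes p v :: "'a \<Rightarrow> real"
  assumes [measurable]: "p \<in> borel_measurable N" "v \<in> borel_measurable N"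
  shows "(\<lambda>w. indicator {u. u < p w} (v w) :: real) \<in> borel_measurable N"
  unfolding indicator_def by simp

lemma measurable_coeff:
  assumes "l \<ge> 1"
  shows "(\<lambda>z. z l) \<in> borel_measurable coeff_space"
proof -
  have "(\<lambda>z. z l) \<in> measurable coeff_space (restrict_space borel {-1..1::real})"
    using assms unfolding coeff_space_def by (intro measurable_component_singleton) auto
  then show ?thesis
    by (simp add: measurable_restrict_space2_iff)
qed

lemma coeff_space_bound: "z \<in> space coeff_space \<Longrightarrow> l \<ge> 1 \<Longrightarrow> \<bar>z l\<bar> \<le> 1"
  by (force simp: coeff_space_def space_PiM space_restrict_space PiE_iff abs_le_iff)

lemma measurable_series_fun [measurable]:
  "(\<lambda>z. series_fun b \<omega> \<phi> z x) \<in> borel_measurable coeff_space"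
  unfolding series_fun_def
  by (intro borel_measurable_add borel_measurable_suminf borel_measurable_times
      borel_measurable_const measurable_coeff) simp

lemma measurable_partial_sum [measurable]:
  "(\<lambda>z. partial_sum b \<omega> \<phi> z x r) \<in> borel_measurable coeff_space"
  unfolding partial_sum_def
  by (intro borel_measurable_add borel_measurable_sum borel_measurable_times
      borel_measurable_const measurable_coeff) simp

text \<open>
  Stopping at a given stage is a comparison of two measurable functions, and the stopping time is
  the least such stage; joint measurability in coefficients and threshold is what Fubini's
  theorem needs.
\<close>

lemma measurable_lazy_time:
  "(\<lambda>w. lazy_time b \<omega> \<phi> (fst w) (snd w) x) \<in> measurable (coeff_space \<Otimes>\<^sub>M borel) (count_space UNIV)"
proof -
  let ?N = "coeff_space \<Otimes>\<^sub>M (borel :: real measure)"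
  have *: "lazy_test b \<omega> \<phi> z u x r \<noteq> None \<longleftrightarrow>
      u < partial_sum b \<omega> \<phi> z x r - tail_bound \<omega> r \<or> u > partial_sum b \<omega> \<phi> z x r + tail_bound \<omega> r"
    for z u r by (simp add: lazy_test_def)
  have stop [measurable]: "Measurable.pred ?N (\<lambda>w. lazy_test b \<omega> \<phi> (fst w) (snd w) x r \<noteq> None)" for r
    unfolding * by measurable
  have "(\<lambda>w. LEAST r. lazy_test b \<omega> \<phi> (fst w) (snd w) x r \<noteq> None) \<in> measurable ?N (count_space UNIV)"
    using stop by (rule measurable_Least)
  then have "(\<lambda>w. enat (LEAST r. lazy_test b \<omega> \<phi> (fst w) (snd w) x r \<noteq> None))
      \<in> measurable ?N (count_space UNIV)"
    by (rule measurable_compose) simp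
  then show ?thesis
    unfolding lazy_time_def by (intro measurable_If) measurable
qed

section \<open>The mean number of reveals\<close>

text \<open>
  The mean of a variable with values in \<open>{0, 1, \<dots>, \<infinity>}\<close> is the sum of its tail probabilities.
\<close>

lemma (in lazy_series) expected_lazy_time_le:
  assumes z: "z \<in> space coeff_space"
  shows "(\<integral>\<^sup>+ u. ennreal_of_enat (lazy_time b \<omega> \<phi> z u x) \<partial>unif)
           \<le> (\<Sum>r. ennreal (min 1 (2 * tail_bound \<omega> r)))"
proof -
  interpret prob_space unif by (rule prob_space_unif)
  have "(\<lambda>u. lazy_time b \<omega> \<phi> z u x) \<in> measurable borel (count_space UNIV)"
    using measurable_compose[OF measurable_Pair1'[OF z] measurable_lazy_time[of b \<omega> \<phi> x]] by simp
  then have "(\<lambda>u. lazy_time b \<omega> \<phi> z u x) \<in> measurable unif (count_space UNIV)"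
    by (simp cong: measurable_cong_sets)
  then have "(\<integral>\<^sup>+ u. ennreal_of_enat (lazy_time b \<omega> \<phi> z u x) \<partial>unif)
      = (\<Sum>r. emeasure unif {u \<in> space unif. enat r < lazy_time b \<omega> \<phi> z u x})"
    by (rule nn_integral_enat_function)
  also have "\<dots> \<le> (\<Sum>r. ennreal (min 1 (2 * tail_bound \<omega> r)))"
    unfolding emeasure_eq_measure
    by (intro suminf_le summableI ennreal_leI measure_unif_undecided[where z = z]) simp
  finally show ?thesis .
qed

lemma tail_bound_geometric:
  assumes \<rho>: "0 < \<rho>" "\<rho> < 1"
    and \<omega>: "\<And>l. l \<ge> 1 \<Longrightarrow> \<bar>\<omega> l\<bar> = A * (1 - \<rho>) * \<rho> ^ (l - 1)"
  shows "tail_bound \<omega> r = A * \<rho> ^ r"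
proof -
  have "(\<lambda>l. \<rho> ^ l) sums (1 / (1 - \<rho>))"
    using \<rho> by (intro geometric_sums) simp
  then have "(\<lambda>l. A * (1 - \<rho>) * \<rho> ^ r * \<rho> ^ l) sums (A * (1 - \<rho>) * \<rho> ^ r * (1 / (1 - \<rho>)))"
    by (rule sums_mult)
  moreover have "\<bar>\<omega> (r + Suc l)\<bar> = A * (1 - \<rho>) * \<rho> ^ r * \<rho> ^ l" for l
    by (simp add: \<omega> power_add)
  ultimately have "(\<lambda>l. \<bar>\<omega> (r + Suc l)\<bar>) sums (A * \<rho> ^ r)"
    using \<rho> by simp
  then show ?thesis
    unfolding tail_bound_def by (rule sums_unique[symmetric])
qed

lemma suminf_truncated_geometric_le:
  fixes A \<rho> :: real
  assumes "0 \<le> A" "0 < \<rho>" "\<rho> < 1"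
  shows "(\<Sum>r. ennreal (min 1 (2 * (A * \<rho> ^ r)))) \<le> ennreal (2 * A / (1 - \<rho>))"
proof -
  have "(\<lambda>r. 2 * A * \<rho> ^ r) sums (2 * A * (1 / (1 - \<rho>)))"
    using assms by (intro sums_mult geometric_sums) simp
  then have "(\<Sum>r. ennreal (2 * A * \<rho> ^ r)) = ennreal (2 * A / (1 - \<rho>))"
    using assms by (intro suminf_ennreal_eq) auto
  moreover have "(\<Sum>r. ennreal (min 1 (2 * (A * \<rho> ^ r)))) \<le> (\<Sum>r. ennreal (2 * A * \<rho> ^ r))"
    by (intro suminf_le summableI ennreal_leI) simp
  ultimately show ?thesis by simp
qed

section \<open>The lazy decision procedure\<close>

theorem theorem4p2:
  fixes D :: "'d measure" and \<phi> :: "nat \<Rightarrow> 'd \<Rightarrow> real"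
    and b A :: real and \<omega> :: "nat \<Rightarrow> real"
    and M :: "'s measure" and \<xi> :: "'s \<Rightarrow> nat \<Rightarrow> real" and U :: "'s \<Rightarrow> real"
    and \<nu> :: "nat \<Rightarrow> real measure"
    and f :: "'s \<Rightarrow> 'd \<Rightarrow> real" and R :: "nat \<Rightarrow> real" and J :: "'s \<Rightarrow> 'd \<Rightarrow> real"
    and \<tau> :: "'s \<Rightarrow> 'd \<Rightarrow> enat"
  assumes phi_meas: "\<And>l. l \<ge> 1 \<Longrightarrow> \<phi> l \<in> borel_measurable D"
    and phi_bound: "\<And>l x. l \<ge> 1 \<Longrightarrow> x \<in> space D \<Longrightarrow> \<bar>\<phi> l x\<bar> \<le> 1"
    and M: "prob_space M"
    and xi_meas: "\<xi> \<in> measurable M coeff_space"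
    and prior_prob: "\<And>l. l \<ge> 1 \<Longrightarrow> prob_space (\<nu> l)"
    and prior_sets: "\<And>l. l \<ge> 1 \<Longrightarrow> sets (\<nu> l) = sets (restrict_space borel {-1..1})"
    and xi_law: "distr M coeff_space \<xi> = PiM {1..} \<nu>"
    and U_meas: "U \<in> borel_measurable M"
    and U_law: "distr M borel U = uniform_measure lborel {0<..<1}"
    and U_indep: "prob_space.indep_set M (sets (gen_sigma M U borel)) (sets (gen_sigma M \<xi> coeff_space))"
    and omega_summable: "summable (\<lambda>l. \<bar>\<omega> (Suc l)\<bar>)"
    and A_def: "A = (\<Sum>l. \<bar>\<omega> (Suc l)\<bar>)"
    and A_less: "A < min b (1 - b)"
    and f_def: "f = (\<lambda>s. series_fun b \<omega> \<phi> (\<xi> s))"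
    and R_def: "R = tail_bound \<omega>"
    and J_def: "J = (\<lambda>s. J_fun (f s) (U s))"
    and tau_def: "\<tau> = (\<lambda>s. lazy_time b \<omega> \<phi> (\<xi> s) (U s))"
  shows
    "(\<lambda>s. restrict (f s) (space D)) \<in> measurable M (\<Pi>\<^sub>M y\<in>space D. borel) \<and>
     (\<forall>x\<in>space D.
        (\<lambda>s. \<tau> s x) \<in> measurable M (count_space UNIV) \<and>
        (\<lambda>s. J s x) \<in> borel_measurable M \<and>
        (\<forall>s\<in>space M. 0 \<le> f s x \<and> f s x \<le> 1) \<and>
        (AE s in M. \<tau> s x \<noteq> \<infinity> \<and> lazy_output b \<omega> \<phi> (\<xi> s) (U s) x = Some (J s x)) \<and>
        (\<forall>B\<in>sets borel. AE s in M.
           real_cond_exp M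
             (gen_sigma M (\<lambda>s. restrict (f s) (space D)) (\<Pi>\<^sub>M y\<in>space D. borel))
             (\<lambda>s. indicator B (J s x)) s
           = measure_pmf.prob (bernoulli01 (f s x)) B) \<and>
        (\<forall>r. AE s in M.
           real_cond_exp M (gen_sigma M \<xi> coeff_space)
             (indicator {s \<in> space M. \<tau> s x > enat r}) s \<le> min 1 (2 * R r)) \<and>
        (AE s in M.
           nn_cond_exp M (gen_sigma M \<xi> coeff_space) (\<lambda>s. ennreal_of_enat (\<tau> s x)) s
           \<le> (\<Sum>r. ennreal (min 1 (2 * R r))))) \<and>
     (\<forall>\<rho>. 0 < \<rho> \<and> \<rho> < 1 \<and> (\<forall>l\<ge>1. \<bar>\<omega> l\<bar> = A * (1 - \<rho>) * \<rho> ^ (l - 1)) \<longrightarrow>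
        (\<forall>r. R r = A * \<rho> ^ r) \<and>
        (2 * A \<le> 1 \<longrightarrow>
          (\<forall>x\<in>space D.
             (\<integral>\<^sup>+ s. ennreal_of_enat (\<tau> s x) \<partial>M) \<le> ennreal (2 * A / (1 - \<rho>)))))"

proof -
  interpret prob_space M by (rule M)
  let ?PD = "\<Pi>\<^sub>M y\<in>space D. (borel :: real measure)"
  define \<Phi> where "\<Phi> z = restrict (series_fun b \<omega> \<phi> z) (space D)" for z
  note xi_meas [measurable] U_meas [measurable]
  interpret coeff: indep_pair M coeff_space \<xi> borel U
    using xi_meas U_meas U_indep by unfold_locales
  have \<Phi> [measurable]: "\<Phi> \<in> measurable coeff_space ?PD"
    unfolding \<Phi>_def by (intro measurable_restrict measurable_series_fun)
  have f\<Phi>: "(\<lambda>s. restrict (f s) (space D)) = (\<lambda>s. \<Phi> (\<xi> s))"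
    by (simp add: f_def \<Phi>_def)
  have f_meas: "(\<lambda>s. restrict (f s) (space D)) \<in> measurable M ?PD"
    unfolding f\<Phi> by measurable
  \<comment> \<open>The random function generates a \<open>\<sigma>\<close>-algebra contained in that of \<open>\<xi>\<close>, so independence is inherited.\<close>
  interpret val: indep_pair M ?PD "\<lambda>s. restrict (f s) (space D)" borel U
  proof
    have "\<xi> \<in> measurable (gen_sigma M \<xi> coeff_space) coeff_space"
      using measurable_space[OF xi_meas] by (intro measurable_vimage_algebra1) auto
    from measurable_compose[OF this \<Phi>]
    have "sets (gen_sigma M (\<lambda>s. restrict (f s) (space D)) ?PD) \<subseteq> sets (gen_sigma M \<xi> coeff_space)"
      unfolding f\<Phi> by (intro sets_image_in_sets) auto
    then show "indep_set (sets (gen_sigma M U borel)) (sets (gen_sigma M (\<lambda>s. restrict (f s) (space D)) ?PD))"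
      using U_indep unfolding indep_sets2_eq by blast
  qed (use f_meas U_meas in auto)
  have coeffs: "\<bar>\<xi> s l\<bar> \<le> 1" if "s \<in> space M" "l \<ge> 1" for s l
    using coeff_space_bound[OF measurable_space[OF xi_meas that(1)] that(2)] .
  have pointwise:
    "(\<lambda>s. \<tau> s x) \<in> measurable M (count_space UNIV) \<and>
     (\<lambda>s. J s x) \<in> borel_measurable M \<and>
     (\<forall>s\<in>space M. 0 \<le> f s x \<and> f s x \<le> 1) \<and>
     (AE s in M. \<tau> s x \<noteq> \<infinity> \<and> lazy_output b \<omega> \<phi> (\<xi> s) (U s) x = Some (J s x)) \<and>
     (\<forall>B\<in>sets borel. AE s in M.
        real_cond_exp M (gen_sigma M (\<lambda>s. restrict (f s) (space D)) ?PD)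
          (\<lambda>s. indicator B (J s x)) s
        = measure_pmf.prob (bernoulli01 (f s x)) B) \<and>
     (\<forall>r. AE s in M.
        real_cond_exp M (gen_sigma M \<xi> coeff_space)
          (indicator {s \<in> space M. \<tau> s x > enat r}) s \<le> min 1 (2 * R r)) \<and>
     (AE s in M.
        nn_cond_exp M (gen_sigma M \<xi> coeff_space) (\<lambda>s. ennreal_of_enat (\<tau> s x)) s
        \<le> (\<Sum>r. ennreal (min 1 (2 * R r)))) \<and>
     (\<integral>\<^sup>+ s. ennreal_of_enat (\<tau> s x) \<partial>M) \<le> (\<Sum>r. ennreal (min 1 (2 * R r)))"
    if x: "x \<in> space D" for x
  proof -
    interpret lazy_series b \<omega> \<phi> x
      using omega_summable phi_bound x by unfold_locales auto
    note lt [measurable] = measurable_lazy_time[of b \<omega> \<phi> x]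
    have pair: "(\<lambda>s. (\<xi> s, U s)) \<in> measurable M (coeff_space \<Otimes>\<^sub>M borel)" by measurable
    have tau_meas: "(\<lambda>s. \<tau> s x) \<in> measurable M (count_space UNIV)"
      using measurable_compose[OF pair lt] by (simp add: tau_def)
    have fx_meas: "(\<lambda>s. f s x) \<in> borel_measurable M"
      unfolding f_def by measurable
    have J_meas: "(\<lambda>s. J s x) \<in> borel_measurable M"
      unfolding J_def J_fun_def by (intro measurable_threshold fx_meas U_meas)
    have f_range: "0 \<le> f s x" "f s x \<le> 1" if s: "s \<in> space M" for s
    proof -
      \<comment> \<open>With no coefficient revealed, the truncation is \<open>b\<close> and the tail bound is \<open>A\<close>.\<close>
      have "\<bar>f s x - b\<bar> \<le> A"
        using truncation_error[of "\<xi> s" 0] coeffs[OF s]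
        by (simp add: f_def A_def partial_sum_def tail_bound_def)
      then show "0 \<le> f s x" "f s x \<le> 1" using A_less by auto
    qed
    have stops: "AE s in M. \<tau> s x \<noteq> \<infinity>"
    proof -
      have "(\<integral>\<^sup>+ s. of_bool (\<tau> s x = \<infinity>) \<partial>M)
          = (\<integral>\<^sup>+ s. (\<integral>\<^sup>+ u. of_bool (lazy_time b \<omega> \<phi> (\<xi> s) u x = \<infinity>) \<partial>unif) \<partial>M)"
        using coeff.nn_integral_pair[of "\<lambda>w. of_bool (lazy_time b \<omega> \<phi> (fst w) (snd w) x = \<infinity>)"]
        by (simp add: tau_def U_law)
      also have "\<dots> = (\<integral>\<^sup>+ s. 0 \<partial>M)"
      proof (intro nn_integral_cong)
        fix s assume "s \<in> space M"
        then have "Measurable.pred borel (\<lambda>u. lazy_time b \<omega> \<phi> (\<xi> s) u x = \<infinity>)"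
          using measurable_compose[OF measurable_Pair1'[OF measurable_space[OF xi_meas]] lt] by simp
        then have "{u. lazy_time b \<omega> \<phi> (\<xi> s) u x = \<infinity>} \<in> sets unif" by simp
        then have "(\<integral>\<^sup>+ u. indicator {u. lazy_time b \<omega> \<phi> (\<xi> s) u x = \<infinity>} u \<partial>unif)
            = emeasure unif {u. lazy_time b \<omega> \<phi> (\<xi> s) u x = \<infinity>}"
          by (rule nn_integral_indicator)
        also have "\<dots> = 0"
          using finite_measure.emeasure_eq_measure[OF prob_space.finite_measure[OF prob_space_unif]]
          by (simp only: measure_unif_never ennreal_0)
        finally show "(\<integral>\<^sup>+ u. of_bool (lazy_time b \<omega> \<phi> (\<xi> s) u x = \<infinity>) \<partial>unif) = 0"
          by (simp only: indicator_def mem_Collect_eq)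
      qed
      finally have "(\<integral>\<^sup>+ s. of_bool (\<tau> s x = \<infinity>) \<partial>M) = 0" by simp
      then have "AE s in M. (of_bool (\<tau> s x = \<infinity>) :: ennreal) = 0"
        using tau_meas by (subst (asm) nn_integral_0_iff_AE) auto
      then show ?thesis by simp
    qed
    have returns: "AE s in M. \<tau> s x \<noteq> \<infinity> \<and> lazy_output b \<omega> \<phi> (\<xi> s) (U s) x = Some (J s x)"
      using stops
    proof (rule AE_mp, intro AE_I2 impI conjI)
      fix s assume "s \<in> space M" "\<tau> s x \<noteq> \<infinity>"
      then show "lazy_output b \<omega> \<phi> (\<xi> s) (U s) x = Some (J s x)"
        using lazy_output_correct[of "\<xi> s" "U s"] coeffs by (simp add: tau_def J_def f_def)
    qed
    have bern: "AE s in M.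
        real_cond_exp M (gen_sigma M (\<lambda>s. restrict (f s) (space D)) ?PD)
          (\<lambda>s. indicator B (J s x)) s
        = measure_pmf.prob (bernoulli01 (f s x)) B" if B: "B \<in> sets borel" for B
    proof -
      let ?P = "\<lambda>p u. indicator {u. u < p x} u \<in> B"
      have "(\<lambda>w. indicator {u. u < fst w x} (snd w) :: real) \<in> borel_measurable (?PD \<Otimes>\<^sub>M borel)"
        using x by (intro measurable_threshold measurable_compose[OF measurable_fst measurable_component_singleton] measurable_snd)
      then have "Measurable.pred (?PD \<Otimes>\<^sub>M borel) (\<lambda>w. ?P (fst w) (snd w))"
        by (rule pred_sets2[OF B])
      from val.real_cond_exp_pair[OF this, of "\<lambda>s. indicator B (J s x)"]
      have "AE s in M. real_cond_exp M (gen_sigma M (\<lambda>s. restrict (f s) (space D)) ?PD)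
          (\<lambda>s. indicator B (J s x)) s = measure unif {u. ?P (f s) u}"
        using x by (simp add: J_def J_fun_def U_law indicator_def[of B])
      then show ?thesis
        by (rule AE_mp, intro AE_I2) (simp add: measure_unif_threshold f_range)
    qed
    have tail: "AE s in M. real_cond_exp M (gen_sigma M \<xi> coeff_space)
          (indicator {s \<in> space M. \<tau> s x > enat r}) s \<le> min 1 (2 * R r)" for r
    proof -
      let ?P = "\<lambda>z u. enat r < lazy_time b \<omega> \<phi> z u x"
      have "Measurable.pred (coeff_space \<Otimes>\<^sub>M borel) (\<lambda>w. ?P (fst w) (snd w))"
        by measurable
      from coeff.real_cond_exp_pair[OF this, of "indicator {s \<in> space M. \<tau> s x > enat r}"]
      have "AE s in M. real_cond_exp M (gen_sigma M \<xi> coeff_space)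
          (indicator {s \<in> space M. \<tau> s x > enat r}) s = measure unif {u. ?P (\<xi> s) u}"
        by (simp add: tau_def U_law indicator_def)
      moreover have "measure unif {u. ?P z u} \<le> min 1 (2 * R r)" for z
        unfolding R_def by (rule measure_unif_undecided[where z = z]) simp
      ultimately show ?thesis
        by (elim AE_mp, intro AE_I2 impI) (simp only:)
    qed
    have mean: "(\<integral>\<^sup>+ u. ennreal_of_enat (lazy_time b \<omega> \<phi> (\<xi> s) u x) \<partial>distr M borel U)
        \<le> (\<Sum>r. ennreal (min 1 (2 * R r)))" if "s \<in> space M" for s
      unfolding U_law R_def by (rule expected_lazy_time_le[OF measurable_space[OF xi_meas that]])
    have count: "(\<lambda>w. ennreal_of_enat (lazy_time b \<omega> \<phi> (fst w) (snd w) x)) \<in> borel_measurable (coeff_space \<Otimes>\<^sub>M borel)"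
      by measurable
    have cond_mean: "AE s in M. nn_cond_exp M (gen_sigma M \<xi> coeff_space) (\<lambda>s. ennreal_of_enat (\<tau> s x)) s
        \<le> (\<Sum>r. ennreal (min 1 (2 * R r)))"
      using coeff.nn_cond_exp_pair[OF count]
      by (rule AE_mp, intro AE_I2) (simp add: tau_def mean)
    have "(\<integral>\<^sup>+ s. ennreal_of_enat (\<tau> s x) \<partial>M) \<le> (\<integral>\<^sup>+ s. (\<Sum>r. ennreal (min 1 (2 * R r))) \<partial>M)"
      using coeff.nn_integral_pair[OF count] mean
      by (simp add: tau_def nn_integral_mono del: nn_integral_const)
    then have total: "(\<integral>\<^sup>+ s. ennreal_of_enat (\<tau> s x) \<partial>M) \<le> (\<Sum>r. ennreal (min 1 (2 * R r)))"
      by (simp add: emeasure_space_1)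
    show ?thesis
      using tau_meas J_meas f_range returns bern tail cond_mean total by blast
  qed
  have geometric: "R r = A * \<rho> ^ r"
    if "0 < \<rho>" "\<rho> < 1" "\<forall>l\<ge>1. \<bar>\<omega> l\<bar> = A * (1 - \<rho>) * \<rho> ^ (l - 1)" for \<rho> r
    unfolding R_def using that by (intro tail_bound_geometric) auto
  have "0 \<le> A" unfolding A_def by (intro suminf_nonneg omega_summable) simp
  have geometric_mean: "(\<integral>\<^sup>+ s. ennreal_of_enat (\<tau> s x) \<partial>M) \<le> ennreal (2 * A / (1 - \<rho>))"
    if "0 < \<rho>" "\<rho> < 1" "\<forall>l\<ge>1. \<bar>\<omega> l\<bar> = A * (1 - \<rho>) * \<rho> ^ (l - 1)" "x \<in> space D" for \<rho> x
    using pointwise[OF that(4)] suminf_truncated_geometric_le[OF \<open>0 \<le> A\<close> that(1,2)]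
    unfolding geometric[OF that(1-3)] by (blast intro: order_trans)
  show ?thesis
    using f_meas pointwise geometric geometric_mean by blast
qed

end
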